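(* Let $a, b, c, d$ be rational numbers with $a(ad - bc) \neq 0$, let $D = (ad - bc)/(2a^2)$, and let $\mathcal C$, $E^{(D)}$ and $\mathcal E^{(D)}$ (with its projection $\mathcal E^{(D)} \to \mathbb P^1$, $((u:v:w), T) \mapsto T$) be as defined in the context. (1) There exists a nontrivial (non-constant) map $E^{(D)} \to \mathcal E^{(D)}$ such that the composition $E^{(D)} \to \mathcal E^{(D)} \to \mathbb P^1$ with the projection is a constant map. (2) If $(X_t : Y_t : 1)$, $t = 1, 2, 3$, are three rational points on $E^{(D)}$ which are not points of finite order, then $S = \{P_1, P_2, P_3, P_4\}$ is a rational distance set on $\mathcal C: a\,x\,y + b\,x + c\,y + d = 0$ when we choose $$P_1 = \left( -ac + (ad - bc)\,\frac{Y_1 X_2 X_3}{X_1 Y_2 Y_3} \ : \ -ab - a^2\,\frac{X_1 Y_2 Y_3}{Y_1 X_2 X_3} \ : \ a^2 \right),$$ $$P_2 = \left( -ac + (ad - bc)\,\frac{X_1 Y_2 X_3}{Y_1 X_2 Y_3} \ : \ -ab - a^2\,\frac{Y_1 X_2 Y_3}{X_1 Y_2 X_3} \ : \ a^2 \right),$$ $$P_3 = \left( -ac + (ad - bc)\,\frac{X_1 X_2 Y_3}{Y_1 Y_2 X_3} \ : \ -ab - a^2\,\frac{Y_1 Y_2 X_3}{X_1 X_2 Y_3} \ : \ a^2 \right),$$ $$P_4 = \left( -ac + \frac{ad - bc}{4D^2}\,\frac{Y_1 Y_2 Y_3}{X_1 X_2 X_3} \ : \ -ab - 4D^2 a^2\,\frac{X_1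 X_2 X_3}{Y_1 Y_2 Y_3} \ : \ a^2 \right).$$ (3) When $E^{(D)}$ has positive rank (over $\mathbb Q$), there are infinitely many rational distance sets $S$ of four points on the hyperbola $\mathcal C$.
   Context: $\mathcal C = \{(x:y:z) \in \mathbb P^2 : a x y + b x z + c y z + d z^2 = 0\}$, with affine equation $axy + bx + cy + d = 0$. $E^{(D)} = \{(X:Y:Z) \in \mathbb P^2 : Y^2 Z = X^3 - D^2 X Z^2\}$, an elliptic curve over $\mathbb Q$ with identity $(0:1:0)$. The surface $\mathcal E^{(D)}$ is the 2-dimensional variety $$\mathcal E^{(D)} = \left\{ ((u:v:w), T) \in \mathbb P^2 \times \mathbb P^1 : v^4 w^3 = u\,(u + D^2 w)\,(u + D^2 T^4 w)\,(u^2 - D^4 T^4 w^2)^2 \right\},$$ where $T$ is the affine coordinate on $\mathbb P^1$. Homogeneous coordinates $(x:y:z)$ with $z \neq 0$ denote the affine point $(x/z, y/z)$. A rational distance set on $\mathcal C$ is a collection of affine rational points $P_t = (x_t : y_t : 1)$ on $\mathcal C$ whose pairwise distances $\|P_s - P_t\| = \sqrt{(x_s - x_t)^2 + (y_s - y_t)^2}$ are rational numbers. *)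

theory Defs
  imports
    "HOL-Analysis.Analysis"
    "HOL-Algebra.Group"
    "HOL-Algebra.FiniteProduct"
    "HOL-Library.Extended_Nat"
begin

(* A point of projective space over 'a is the set of all its homogeneous coordinate vectors,
   so proj_pt v is a projective point only for v \<noteq> 0. *)

definition proj_pt :: "'a::field ^ 'n \<Rightarrow> ('a ^ 'n) set" where
  "proj_pt v = {k *s v | k. k \<noteq> 0}"

definition hom2 :: "'a::field \<Rightarrow> 'a \<Rightarrow> ('a ^ 2) set" where
  "hom2 s r = proj_pt (vector [s, r])"

definition hom3 :: "'a::field \<Rightarrow> 'a \<Rightarrow> 'a \<Rightarrow> ('a ^ 3) set" where
  "hom3 x y z = proj_pt (vector [x, y, z])"

definition hyperbola :: "'a::field \<Rightarrow> 'a \<Rightarrow> 'a \<Rightarrow> 'a \<Rightarrow> ('a ^ 3) set set" where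
  "hyperbola a b c d =
     {hom3 x y z | x y z.
        (x, y, z) \<noteq> (0, 0, 0) \<and> a * x * y + b * x * z + c * y * z + d * z ^ 2 = 0}"

definition ell_curve :: "'a::field \<Rightarrow> ('a ^ 3) set set" where
  "ell_curve D =
     {hom3 X Y Z | X Y Z.
        (X, Y, Z) \<noteq> (0, 0, 0) \<and> Y ^ 2 * Z = X ^ 3 - D ^ 2 * X * Z ^ 2}"

(* T = s/r, and the equation in T has been multiplied by r^12, which also describes the fibre
   over T = \<infinity>. *)

definition surface :: "'a::field \<Rightarrow> (('a ^ 3) set \<times> ('a ^ 2) set) set" where
  "surface D =
     {(hom3 u v w, hom2 s r) | u v w s r.
        (u, v, w) \<noteq> (0, 0, 0) \<and> (s, r) \<noteq> (0, 0) \<and>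
        v ^ 4 * w ^ 3 * r ^ 12 =
          u * (u + D ^ 2 * w) * (r ^ 4 * u + D ^ 2 * s ^ 4 * w)
            * (r ^ 4 * u ^ 2 - D ^ 4 * s ^ 4 * w ^ 2) ^ 2}"

(* rat_form m F: F is (the function given by) a homogeneous polynomial of degree m with
   rational coefficients. *)

inductive rat_form :: "nat \<Rightarrow> ('a::field_char_0 ^ 'n \<Rightarrow> 'a) \<Rightarrow> bool" where
  const: "rat_form 0 (\<lambda>v. of_rat q)"
| coord: "rat_form 1 (\<lambda>v. v $ i)"
| add: "rat_form m F \<Longrightarrow> rat_form m G \<Longrightarrow> rat_form m (\<lambda>v. F v + G v)"
| mult: "rat_form m F \<Longrightarrow> rat_form n G \<Longrightarrow> rat_form (m + n) (\<lambda>v. F v * G v)"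

(* Morphism over the rationals from a projective set V to a projective space: around each point
   of V there is a basic Zariski-open neighbourhood H \<noteq> 0 on which f is given by forms F of
   one common degree without common zero. *)

definition regular_map_on ::
    "('a::field_char_0 ^ 'n) set set \<Rightarrow> (('a ^ 'n) set \<Rightarrow> ('a ^ 'm) set) \<Rightarrow> bool" where
  "regular_map_on V f \<longleftrightarrow>
     (\<forall>v. v \<noteq> 0 \<and> proj_pt v \<in> V \<longrightarrow>
        (\<exists>e H m F. rat_form e H \<and> (\<forall>i. rat_form m (\<lambda>w. F w $ i)) \<and> H v \<noteq> 0 \<and>
           (\<forall>w. w \<noteq> 0 \<and> proj_pt w \<in> V \<and> H w \<noteq> 0 \<longrightarrow>
              F w \<noteq> 0 \<and> f (proj_pt w) = proj_pt (F w))))"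

(* By the universal property of the product, a morphism into P^2 \<times> P^1 is a pair of
   morphisms. *)

definition morphism_to_surface ::
    "'a::field_char_0 \<Rightarrow> (('a ^ 3) set \<Rightarrow> ('a ^ 3) set \<times> ('a ^ 2) set) \<Rightarrow> bool" where
  "morphism_to_surface D f \<longleftrightarrow>
     f ` ell_curve D \<subseteq> surface D \<and>
     regular_map_on (ell_curve D) (\<lambda>P. fst (f P)) \<and>
     regular_map_on (ell_curve D) (\<lambda>P. snd (f P))"

definition affine_coords :: "('a::field ^ 3) set \<Rightarrow> 'a \<times> 'a" where
  "affine_coords P = (THE (x, y). P = hom3 x y 1)"

(* Chord-tangent addition; l is the slope of the chord, or of the tangent if the points agree. *)

definition ell_add :: "'a::field \<Rightarrow> ('a ^ 3) set \<Rightarrow> ('a ^ 3) set \<Rightarrow> ('a ^ 3) set" where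
  "ell_add D P Q =
     (if P = hom3 0 1 0 then Q
      else if Q = hom3 0 1 0 then P
      else
        let (x1, y1) = affine_coords P; (x2, y2) = affine_coords Q
        in if x1 = x2 \<and> y1 = - y2 then hom3 0 1 0
           else
             let l = (if x1 = x2 then (3 * x1 ^ 2 - D ^ 2) / (2 * y1)
                      else (y2 - y1) / (x2 - x1));
                 x3 = l ^ 2 - x1 - x2
             in hom3 x3 (l * (x1 - x3) - y1) 1)"

definition ell_group :: "'a::field \<Rightarrow> ('a ^ 3) set monoid" where
  "ell_group D = \<lparr>carrier = ell_curve D, mult = ell_add D, one = hom3 0 1 0\<rparr>"

definition finite_order :: "('g, 'r) monoid_scheme \<Rightarrow> 'g \<Rightarrow> bool" where
  "finite_order G x \<longleftrightarrow> (\<exists>n::nat. n > 0 \<and> x [^]\<^bsub>G\<^esub> n = \<one>\<^bsub>G\<^esub>)"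

definition int_independent :: "('g, 'r) monoid_scheme \<Rightarrow> 'g set \<Rightarrow> bool" where
  "int_independent G A \<longleftrightarrow>
     (\<forall>n :: 'g \<Rightarrow> int.
        finprod G (\<lambda>x. x [^]\<^bsub>G\<^esub> n x) A = \<one>\<^bsub>G\<^esub> \<longrightarrow> (\<forall>x\<in>A. n x = 0))"

definition ab_rank :: "('g, 'r) monoid_scheme \<Rightarrow> enat" where
  "ab_rank G =
     (SUP A\<in>{A. finite A \<and> A \<subseteq> carrier G \<and> int_independent G A}. enat (card A))"

definition rational_distance_set_on :: "(rat ^ 3) set set \<Rightarrow> (rat ^ 3) set set \<Rightarrow> bool" where
  "rational_distance_set_on C S \<longleftrightarrow>
     S \<subseteq> C \<and>
     (\<forall>P\<in>S. \<exists>x y. P = hom3 x y 1) \<and>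
     (\<forall>x y x' y'. hom3 x y 1 \<in> S \<and> hom3 x' y' 1 \<in> S \<longrightarrow>
        sqrt (of_rat ((x - x') ^ 2 + (y - y') ^ 2)) \<in> \<rat>)"

end

theory Submission
  imports Defs
begin

text \<open>
  The fibre of the surface over $T = 0$ is $v^4 w^3 = u^6 (u + D^2 w)$. Writing an affine point of
  it as $u = X^2 - D^2$, $v = u Y$ turns its equation into $u^4 Y^4 = u^6 X^2$, a consequence of
  $Y^4 = X^2 (X^2 - D^2)^2$, which holds on $E^{(D)}$ because
  $Y^2 = X (X^2 - D^2)$ there. So $(X, Y) \<mapsto> (X^2 - D^2 : (X^2 - D^2) Y : 1)$ sends
  $E^{(D)}$ into one fibre, and only the point at infinity needs another formula
  (\<open>fibre_point_near_infinity\<close>).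

  For the distances, the affine points of the hyperbola are
  $(2 D r - c/a, \, -1/r - b/a)$ with $r \<noteq> 0$, and the squared distance between the points with
  parameters $r$ and $s$ is $(r - s)^2 (4 D^2 + 1/(rs)^2)$. It is a rational square as soon as
  $4 D^2 + 1/(rs)^2$ is one. A point of $E^{(D)}$ has a slope $t = Y/X$ with
  $t^2 = X - D^2/X$, hence $t^4 + 4 D^2 = (X + D^2/X)^2$. With three slopes $t_1, t_2, t_3$, the
  four parameters $t_i / (t_j t_k)$ and $t_1 t_2 t_3 / (4 D^2)$ have pairwise products
  $1/t_k^2$ and $t_k^2/(4 D^2)$, and each such product makes the factor a square by the identity
  for $t_k$ (\<open>slope_params_square\<close>).

  If the rank is positive, some point $P$ has infinite order. To see that its multiples are
  distinct, it suffices that adding $P$ is injective, which follows from the single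
  instance $(Q + P) + (-P) = Q$ of associativity (\<open>ell_add_cancel\<close>): the line through $Q$ and
  $P$, reflected in the $X$-axis, is the line through $Q + P$ and $-P$. Infinitely many points
  have infinitely many slopes, and for two fixed generic slopes the four-point sets obtained by
  varying the third slope cover infinitely many points of the hyperbola, so that there are
  infinitely many of them.
\<close>

section \<open>Projective points\<close>

lemma proj_pt_eq_iff:
  fixes v w :: "'a::field ^ 'n"
  shows "proj_pt v = proj_pt w \<longleftrightarrow> (\<exists>k. k \<noteq> 0 \<and> w = k *s v)"
proof
  assume "proj_pt v = proj_pt w"
  moreover have "w \<in> proj_pt w"
    unfolding proj_pt_def by (auto intro!: exI[of _ 1])
  ultimately have "w \<in> proj_pt v"
    by simp
  then show "\<exists>k. k \<noteq> 0 \<and> w = k *s v"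
    unfolding proj_pt_def by blast
next
  assume "\<exists>k. k \<noteq> 0 \<and> w = k *s v"
  then obtain k where k: "k \<noteq> 0" "w = k *s v"
    by blast
  have "l *s v = (l / k) *s w" for l
    using k by (simp add: vector_smult_assoc)
  moreover have "l *s w = (l * k) *s v" for l
    using k by (simp add: vector_smult_assoc)
  ultimately show "proj_pt v = proj_pt w"
    unfolding proj_pt_def using k(1)
    by (metis (no_types, opaque_lifting) divide_eq_0_iff mult_eq_0_iff)
qed

lemma hom3_eq_iff:
  "hom3 x y z = hom3 x' y' z' \<longleftrightarrow>
     (\<exists>k. k \<noteq> 0 \<and> x' = k * x \<and> y' = k * y \<and> z' = k * z)"
  unfolding hom3_def proj_pt_eq_iff by (simp add: vec_eq_iff forall_3)

lemma hom3_scale: "k \<noteq> 0 \<Longrightarrow> hom3 (k * x) (k * y) (k * z) = hom3 x y z"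
  by (metis hom3_eq_iff)

lemma hom3_normalize: "z \<noteq> 0 \<Longrightarrow> hom3 x y z = hom3 (x / z) (y / z) 1"
  using hom3_scale[of z "x / z" "y / z" 1] by simp

lemma hom3_affine_eq_iff [simp]: "hom3 x y 1 = hom3 x' y' 1 \<longleftrightarrow> x = x' \<and> y = y'"
  by (auto simp: hom3_eq_iff)

lemma hom3_affine_neq_infinity [simp]:
  "hom3 x y 1 \<noteq> hom3 0 1 0" "hom3 0 1 0 \<noteq> hom3 x y 1"
  by (auto simp: hom3_eq_iff)

lemma affine_coords_hom3 [simp]: "affine_coords (hom3 x y 1) = (x, y)"
  unfolding affine_coords_def by (rule the_equality) auto

lemma proj_pt_eq_hom3: "proj_pt v = hom3 (v $ 1) (v $ 2) (v $ 3)"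
  unfolding hom3_def by (rule arg_cong[of _ _ proj_pt]) (simp add: vec_eq_iff forall_3)

lemma hom3_in_ell_curve_iff:
  assumes "(X, Y, Z) \<noteq> (0, 0, 0)"
  shows "hom3 X Y Z \<in> ell_curve D \<longleftrightarrow> Y ^ 2 * Z = X ^ 3 - D ^ 2 * X * Z ^ 2"
proof
  assume "hom3 X Y Z \<in> ell_curve D"
  then obtain X' Y' Z' where eq: "Y' ^ 2 * Z' = X' ^ 3 - D ^ 2 * X' * Z' ^ 2"
    and "hom3 X Y Z = hom3 X' Y' Z'"
    unfolding ell_curve_def by blast
  then obtain k where k: "k \<noteq> 0" "X' = k * X" "Y' = k * Y" "Z' = k * Z"
    by (auto simp: hom3_eq_iff)
  have "k ^ 3 * (Y ^ 2 * Z) = k ^ 3 * (X ^ 3 - D ^ 2 * X * Z ^ 2)"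
    using eq unfolding k by (simp add: algebra_simps power2_eq_square power3_eq_cube)
  then show "Y ^ 2 * Z = X ^ 3 - D ^ 2 * X * Z ^ 2"
    using k(1) by simp
qed (use assms ell_curve_def in blast)

lemma affine_in_ell_curve_iff:
  "hom3 X Y 1 \<in> ell_curve D \<longleftrightarrow> Y ^ 2 = X ^ 3 - D ^ 2 * X"
  by (subst hom3_in_ell_curve_iff) auto

lemma ell_curve_cases:
  assumes "P \<in> ell_curve D"
  obtains "P = hom3 0 1 0"
  | X Y where "P = hom3 X Y 1" "Y ^ 2 = X ^ 3 - D ^ 2 * X"
proof -
  obtain X Y Z where nz: "(X, Y, Z) \<noteq> (0, 0, 0)"
    and eq: "Y ^ 2 * Z = X ^ 3 - D ^ 2 * X * Z ^ 2" and P: "P = hom3 X Y Z"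
    using assms unfolding ell_curve_def by blast
  show thesis
  proof (cases "Z = 0")
    case True
    then have "X = 0" "Y \<noteq> 0"
      using eq nz by auto
    then have "P = hom3 0 1 0"
      using P True hom3_scale[of Y 0 1 0] by simp
    then show thesis
      by (rule that(1))
  next
    case False
    then have "P = hom3 (X / Z) (Y / Z) 1"
      using P hom3_normalize by blast
    then show thesis
      using that(2) assms affine_in_ell_curve_iff by metis
  qed
qed

lemma infinity_in_ell_curve: "hom3 0 1 0 \<in> ell_curve D"
  by (subst hom3_in_ell_curve_iff) auto

section \<open>A curve isomorphic to the elliptic curve in a fibre of the surface\<close>

lemma rat_form_power:
  assumes "rat_form m F"
  shows "rat_form (n * m) (\<lambda>v. F v ^ n)"
proof (induction n)
  case 0
  show ?case using rat_form.const[of 1] by simp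
next
  case (Suc n)
  show ?case using rat_form.mult[OF assms Suc.IH] by simp
qed

lemma rat_form_scale: "rat_form m F \<Longrightarrow> rat_form m (\<lambda>v. of_rat q * F v)"
  using rat_form.mult[OF rat_form.const, of m F q] by simp

lemma rat_form_diff:
  assumes "rat_form m F" "rat_form m G"
  shows "rat_form m (\<lambda>v. F v - G v)"
  using rat_form.add[OF assms(1) rat_form_scale[OF assms(2), of "-1"]] by (simp add: of_rat_minus)

text \<open>
  The affine formula has poles at the point at infinity. There $v$ has the pole of largest order, so
  the value is $(0:1:0)$.
\<close>

definition fibre_point :: "'a::field \<Rightarrow> ('a ^ 3) set \<Rightarrow> ('a ^ 3) set" where
  "fibre_point D P =
     (if P = hom3 0 1 0 then hom3 0 1 0
      else let (x, y) = affine_coords P in hom3 (x ^ 2 - D ^ 2) ((x ^ 2 - D ^ 2) * y) 1)"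

lemma fibre_point_affine:
  assumes "Z \<noteq> 0"
  shows "fibre_point D (hom3 X Y Z) =
    hom3 ((X ^ 2 - D ^ 2 * Z ^ 2) * Z) ((X ^ 2 - D ^ 2 * Z ^ 2) * Y) (Z ^ 3)"
proof -
  have "fibre_point D (hom3 X Y Z) =
      hom3 ((X / Z) ^ 2 - D ^ 2) (((X / Z) ^ 2 - D ^ 2) * (Y / Z)) 1"
    unfolding hom3_normalize[OF assms] fibre_point_def by simp
  also have "\<dots> = hom3 (Z ^ 3 * ((X / Z) ^ 2 - D ^ 2)) (Z ^ 3 * (((X / Z) ^ 2 - D ^ 2) * (Y / Z)))
      (Z ^ 3 * 1)"
    using assms by (intro hom3_scale[symmetric]) simp
  also have "Z ^ 3 * ((X / Z) ^ 2 - D ^ 2) = (X ^ 2 - D ^ 2 * Z ^ 2) * Z"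
    using assms by (simp add: field_simps power2_eq_square power3_eq_cube)
  also have "Z ^ 3 * (((X / Z) ^ 2 - D ^ 2) * (Y / Z)) = (X ^ 2 - D ^ 2 * Z ^ 2) * Y"
    using assms by (simp add: field_simps power2_eq_square power3_eq_cube)
  finally show ?thesis by simp
qed

text \<open>
  On the curve, $X (X^2 - D^2 Z^2) = Y^2 Z$. Multiplying the affine formula by $X$ and cancelling
  $Z$ therefore gives forms that are still defined at $(0:1:0)$.
\<close>

lemma fibre_point_near_infinity:
  assumes "hom3 X Y Z \<in> ell_curve D" "Y \<noteq> 0"
  shows "fibre_point D (hom3 X Y Z) = hom3 (Y ^ 2 * Z) (Y ^ 3) (X * Z ^ 2)"
proof -
  have eq: "Y ^ 2 * Z = X ^ 3 - D ^ 2 * X * Z ^ 2"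
    using assms hom3_in_ell_curve_iff[of X Y Z D] by simp
  show ?thesis
  proof (cases "Z = 0")
    case True
    then have "X = 0" using eq by simp
    have "hom3 0 Y 0 = hom3 0 1 0" "hom3 0 (Y ^ 3) 0 = hom3 0 1 0"
      using assms(2) hom3_scale[of Y 0 1 0] hom3_scale[of "Y ^ 3" 0 1 0] by simp_all
    then show ?thesis
      using True \<open>X = 0\<close> by (simp add: fibre_point_def)
  next
    case False
    then have X: "X \<noteq> 0" using eq assms(2) by auto
    let ?B = "X ^ 2 - D ^ 2 * Z ^ 2"
    have B: "X * ?B = Y ^ 2 * Z"
      using eq by (simp add: algebra_simps power2_eq_square power3_eq_cube)
    have "hom3 (?B * Z) (?B * Y) (Z ^ 3) = hom3 (X * (?B * Z)) (X * (?B * Y)) (X * Z ^ 3)"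
      using X by (rule hom3_scale[symmetric])
    also have "X * (?B * Z) = Z * (Y ^ 2 * Z)"
      by (simp only: mult.assoc[symmetric] B) (simp add: algebra_simps)
    also have "X * (?B * Y) = Z * Y ^ 3"
      by (simp only: mult.assoc[symmetric] B) (simp add: algebra_simps power2_eq_square power3_eq_cube)
    also have "X * Z ^ 3 = Z * (X * Z ^ 2)"
      by (simp add: power2_eq_square power3_eq_cube)
    also have "hom3 (Z * (Y ^ 2 * Z)) (Z * Y ^ 3) (Z * (X * Z ^ 2)) =
        hom3 (Y ^ 2 * Z) (Y ^ 3) (X * Z ^ 2)"
      using False by (rule hom3_scale)
    finally show ?thesis
      using fibre_point_affine[OF False] by metis
  qed
qed

lemma fibre_point_in_surface:
  assumes "P \<in> ell_curve D"
  shows "(fibre_point D P, hom2 0 1) \<in> surface D"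
  using assms
proof (cases rule: ell_curve_cases)
  case 1
  have "\<exists>u v w s r. (hom3 0 1 0, hom2 0 1) = (hom3 u v w, hom2 s r) \<and>
        (u, v, w) \<noteq> (0, 0, 0) \<and> (s, r) \<noteq> (0, 0) \<and>
        v ^ 4 * w ^ 3 * r ^ 12 =
          u * (u + D ^ 2 * w) * (r ^ 4 * u + D ^ 2 * s ^ 4 * w)
            * (r ^ 4 * u ^ 2 - D ^ 4 * s ^ 4 * w ^ 2) ^ 2"
    by (rule exI[of _ 0], rule exI[of _ 1], rule exI[of _ 0], rule exI[of _ 0], rule exI[of _ 1])
       simp
  then show ?thesis
    unfolding surface_def 1 fibre_point_def by simp
next
  case (2 X Y)
  let ?B = "X ^ 2 - D ^ 2"
  have Y2: "Y ^ 2 = X * ?B"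
    using 2(2) by (simp add: algebra_simps power2_eq_square power3_eq_cube)
  have "(?B * Y) ^ 4 = ?B ^ 4 * (Y ^ 2) ^ 2"
    by (simp add: power_mult_distrib flip: power_mult)
  also have "\<dots> = ?B * (?B + D ^ 2) * ?B * (?B ^ 2) ^ 2"
    unfolding Y2 by (simp add: power_mult_distrib power2_eq_square power4_eq_xxxx mult_ac)
  finally have "(?B * Y) ^ 4 = ?B * (?B + D ^ 2) * ?B * (?B ^ 2) ^ 2" .
  then have "\<exists>u v w s r. (hom3 ?B (?B * Y) 1, hom2 0 1) = (hom3 u v w, hom2 s r) \<and>
        (u, v, w) \<noteq> (0, 0, 0) \<and> (s, r) \<noteq> (0, 0) \<and>
        v ^ 4 * w ^ 3 * r ^ 12 =
          u * (u + D ^ 2 * w) * (r ^ 4 * u + D ^ 2 * s ^ 4 * w)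
            * (r ^ 4 * u ^ 2 - D ^ 4 * s ^ 4 * w ^ 2) ^ 2"
    by (intro exI[of _ ?B] exI[of _ "?B * Y"] exI[of _ 1] exI[of _ 0])
       (simp add: hom2_def)
  then show ?thesis
    unfolding surface_def 2(1) fibre_point_def by simp
qed

text \<open>
  The two charts $Z \<noteq> 0$ and $Y \<noteq> 0$ cover the curve, since $Y = Z = 0$ forces $X = 0$.
\<close>

lemma fibre_point_regular:
  fixes D :: rat
  shows "regular_map_on (ell_curve (of_rat D :: complex)) (fibre_point (of_rat D))"
  unfolding regular_map_on_def
proof (intro allI impI, elim conjE)
  let ?E = "of_rat D :: complex"
  fix v :: "complex ^ 3"
  assume v: "v \<noteq> 0" "proj_pt v \<in> ell_curve ?E"
  have form_B: "rat_form 2 (\<lambda>w::complex^3. w $ 1 ^ 2 - ?E ^ 2 * w $ 3 ^ 2)"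
    using rat_form_diff[OF rat_form_power[OF rat_form.coord[of 1], of 2]
        rat_form_scale[OF rat_form_power[OF rat_form.coord[of 3], of 2], of "D ^ 2"]]
    by (simp add: of_rat_power)
  show "\<exists>e H m F. rat_form e H \<and> (\<forall>i. rat_form m (\<lambda>w. F w $ i)) \<and> H v \<noteq> 0 \<and>
      (\<forall>w. w \<noteq> 0 \<and> proj_pt w \<in> ell_curve ?E \<and> H w \<noteq> 0 \<longrightarrow>
         F w \<noteq> 0 \<and> fibre_point ?E (proj_pt w) = proj_pt (F w))"
  proof (cases "v $ 3 = 0")
    case False
    let ?F = "\<lambda>w::complex^3. vector [(w $ 1 ^ 2 - ?E ^ 2 * w $ 3 ^ 2) * w $ 3,
        (w $ 1 ^ 2 - ?E ^ 2 * w $ 3 ^ 2) * w $ 2, w $ 3 ^ 3] :: complex ^ 3"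
    have "rat_form 3 (\<lambda>w. ?F w $ i)" for i
      using rat_form.mult[OF form_B rat_form.coord[of 3]]
        rat_form.mult[OF form_B rat_form.coord[of 2]]
        rat_form_power[OF rat_form.coord[of "3::3"], of 3]
      using exhaust_3[of i] by auto
    moreover have "?F w \<noteq> 0 \<and> fibre_point ?E (proj_pt w) = proj_pt (?F w)"
      if "w $ 3 \<noteq> 0" for w
      using that fibre_point_affine[OF that]
      by (auto simp: proj_pt_eq_hom3 vec_eq_iff forall_3)
    ultimately show ?thesis
      using rat_form.coord[of "3::3"] False
      by (intro exI[of _ 1] exI[of _ "\<lambda>w. w $ 3"] exI[of _ 3] exI[of _ ?F]) blast
  next
    case True
    let ?F = "\<lambda>w::complex^3. vector [w $ 2 ^ 2 * w $ 3, w $ 2 ^ 3, w $ 1 * w $ 3 ^ 2] :: complex ^ 3"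
    have "v $ 2 \<noteq> 0"
    proof
      assume "v $ 2 = 0"
      then have "v $ 1 \<noteq> 0"
        using v(1) True by (simp add: vec_eq_iff forall_3)
      then show False
        using v(2) True hom3_in_ell_curve_iff[of "v $ 1" "v $ 2" "v $ 3" ?E]
        by (simp add: proj_pt_eq_hom3)
    qed
    moreover have "rat_form 3 (\<lambda>w. ?F w $ i)" for i
      using rat_form.mult[OF rat_form_power[OF rat_form.coord[of "2::3"], of 2] rat_form.coord[of 3]]
        rat_form_power[OF rat_form.coord[of "2::3"], of 3]
        rat_form.mult[OF rat_form.coord[of 1] rat_form_power[OF rat_form.coord[of "3::3"], of 2]]
      using exhaust_3[of i] by (auto simp: eval_nat_numeral)
    moreover have "?F w \<noteq> 0 \<and> fibre_point ?E (proj_pt w) = proj_pt (?F w)"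
      if "proj_pt w \<in> ell_curve ?E" "w $ 2 \<noteq> 0" for w
      using that fibre_point_near_infinity[of "w $ 1" "w $ 2" "w $ 3" ?E]
      by (auto simp: proj_pt_eq_hom3 vec_eq_iff forall_3)
    ultimately show ?thesis
      using rat_form.coord[of "2::3"]
      by (intro exI[of _ 1] exI[of _ "\<lambda>w. w $ 2"] exI[of _ 3] exI[of _ ?F]) blast
  qed
qed

lemma regular_map_on_zero:
  "regular_map_on V (\<lambda>P::(complex^'n) set. hom2 (0::complex) 1)"
  unfolding regular_map_on_def
proof (intro allI impI)
  fix v :: "complex ^ 'n"
  let ?F = "\<lambda>w::complex ^ 'n. vector [0, 1] :: complex ^ 2"
  have "rat_form 0 (\<lambda>w. ?F w $ i)" for i
    using rat_form.const[of 0] rat_form.const[of 1] exhaust_2[of i] by auto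
  moreover have "rat_form 0 (\<lambda>w::complex ^ 'n. 1 :: complex)"
    using rat_form.const[of 1] by simp
  moreover have "?F w \<noteq> 0" for w
    by (simp add: vec_eq_iff forall_2)
  ultimately show "\<exists>e H m F. rat_form e H \<and> (\<forall>i. rat_form m (\<lambda>w. F w $ i)) \<and> H v \<noteq> 0 \<and>
      (\<forall>w. w \<noteq> 0 \<and> proj_pt w \<in> V \<and> H w \<noteq> 0 \<longrightarrow>
         F w \<noteq> 0 \<and> hom2 0 1 = proj_pt (F w))"
    by (intro exI[of _ 0] exI[of _ "\<lambda>w. 1"] exI[of _ ?F]) (auto simp: hom2_def)
qed

lemma fibre_map_exists:
  fixes D :: rat
  assumes "D \<noteq> 0"
  shows "\<exists>f :: (complex ^ 3) set \<Rightarrow> (complex ^ 3) set \<times> (complex ^ 2) set.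
        morphism_to_surface (of_rat D) f \<and>
        \<not> (\<exists>Q. \<forall>P \<in> ell_curve (of_rat D). f P = Q) \<and>
        (\<exists>t. \<forall>P \<in> ell_curve (of_rat D). snd (f P) = t)"
proof (intro exI conjI)
  let ?E = "of_rat D :: complex"
  let ?f = "\<lambda>P. (fibre_point ?E P, hom2 0 1 :: (complex ^ 2) set)"
  show "morphism_to_surface ?E ?f"
    unfolding morphism_to_surface_def
    using fibre_point_in_surface fibre_point_regular regular_map_on_zero by auto
  have "hom3 0 0 1 \<in> ell_curve ?E"
    by (simp add: affine_in_ell_curve_iff)
  moreover have "fibre_point ?E (hom3 0 0 1) \<noteq> fibre_point ?E (hom3 0 1 0)"
    by (simp add: fibre_point_def)
  ultimately show "\<not> (\<exists>Q. \<forall>P \<in> ell_curve ?E. ?f P = Q)"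
    using infinity_in_ell_curve by (metis prod.inject)
  show "\<forall>P \<in> ell_curve ?E. snd (?f P) = hom2 0 1"
    by simp
qed

section \<open>Four points at rational distances\<close>

text \<open>
  The parametrization is kept in homogeneous form with last coordinate $a^2$, and with $1/r$ as a
  separate factor, so that the four points of the theorem are visibly values of it.
\<close>

definition hyperbola_point :: "'a::field \<Rightarrow> 'a \<Rightarrow> 'a \<Rightarrow> 'a \<Rightarrow> 'a \<Rightarrow> ('a ^ 3) set" where
  "hyperbola_point a b c d r =
     hom3 (- a * c + (a * d - b * c) * r) (- a * b - a ^ 2 * (1 / r)) (a ^ 2)"

lemma hyperbola_point_affine:
  fixes a b c d D r :: rat
  assumes "a \<noteq> 0" "D = (a * d - b * c) / (2 * a ^ 2)"
  shows "hyperbola_point a b c d r = hom3 (2 * D * r - c / a) (- 1 / r - b / a) 1"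
proof -
  have "(- a * c + (a * d - b * c) * r) / a ^ 2 = 2 * D * r - c / a"
    using assms(1) unfolding assms(2) by (simp add: field_simps power2_eq_square)
  moreover have "(- a * b - a ^ 2 * (1 / r)) / a ^ 2 = - 1 / r - b / a"
    using assms(1) by (simp add: diff_divide_distrib power2_eq_square)
  ultimately show ?thesis
    unfolding hyperbola_point_def using assms(1) by (subst hom3_normalize) simp_all
qed

lemma hyperbola_point_in_hyperbola:
  fixes a b c d r :: rat
  assumes "a \<noteq> 0" "r \<noteq> 0"
  shows "hyperbola_point a b c d r \<in> hyperbola a b c d"
proof -
  let ?x = "- a * c + (a * d - b * c) * r" and ?y = "- a * b - a ^ 2 * (1 / r)"
  have "a * ?x * ?y + b * ?x * a ^ 2 + c * ?y * a ^ 2 + d * (a ^ 2) ^ 2 = 0"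
    using assms by (simp add: field_simps power2_eq_square)
  then show ?thesis
    unfolding hyperbola_def hyperbola_point_def using assms(1)
    by (intro CollectI exI[of _ ?x] exI[of _ ?y] exI[of _ "a ^ 2"]) simp
qed

text \<open>
  The difference of two points with parameters $r$ and $s$ is
  $(r - s) (2 D, \, 1/(rs))$.
\<close>

lemma hyperbola_points_rational_distance:
  fixes a b c d D :: rat
  assumes "a \<noteq> 0" and D: "D = (a * d - b * c) / (2 * a ^ 2)"
    and nz: "\<And>r. r \<in> R \<Longrightarrow> r \<noteq> 0"
    and sq: "\<And>r s. r \<in> R \<Longrightarrow> s \<in> R \<Longrightarrow> r \<noteq> s \<Longrightarrow> \<exists>w. 4 * D ^ 2 + (1 / (r * s)) ^ 2 = w ^ 2"
  shows "rational_distance_set_on (hyperbola a b c d) (hyperbola_point a b c d ` R)"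
  unfolding rational_distance_set_on_def
proof (intro conjI allI impI)
  show "hyperbola_point a b c d ` R \<subseteq> hyperbola a b c d"
    using hyperbola_point_in_hyperbola assms(1) nz by blast
  show "\<forall>P \<in> hyperbola_point a b c d ` R. \<exists>x y. P = hom3 x y 1"
    using hyperbola_point_affine[OF assms(1) D] by blast
  fix x y x' y'
  assume "hom3 x y 1 \<in> hyperbola_point a b c d ` R \<and> hom3 x' y' 1 \<in> hyperbola_point a b c d ` R"
  then obtain r s where rs: "r \<in> R" "s \<in> R"
    and xy: "x = 2 * D * r - c / a" "y = - 1 / r - b / a"
      "x' = 2 * D * s - c / a" "y' = - 1 / s - b / a"
    by (auto simp: hyperbola_point_affine[OF assms(1) D])
  obtain w where w: "(x - x') ^ 2 + (y - y') ^ 2 = w ^ 2"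
  proof (cases "r = s")
    case True
    then show thesis using that[of 0] xy by simp
  next
    case False
    then obtain w where w: "4 * D ^ 2 + (1 / (r * s)) ^ 2 = w ^ 2"
      using sq rs by blast
    have y: "y - y' = (r - s) * (1 / (r * s))"
      unfolding xy using nz[OF rs(1)] nz[OF rs(2)] by (simp add: field_simps)
    have x: "x - x' = (r - s) * (2 * D)"
      using xy by (simp add: algebra_simps)
    have "(x - x') ^ 2 + (y - y') ^ 2 = (r - s) ^ 2 * (4 * D ^ 2 + (1 / (r * s)) ^ 2)"
      unfolding x y power_mult_distrib by (simp add: algebra_simps)
    then show thesis
      using that[of "(r - s) * w"] w by (simp add: power_mult_distrib)
  qed
  have "sqrt (of_rat ((x - x') ^ 2 + (y - y') ^ 2)) = \<bar>of_rat w\<bar>"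
    unfolding w by (simp add: of_rat_power)
  then show "sqrt (of_rat ((x - x') ^ 2 + (y - y') ^ 2)) \<in> \<rat>"
    by simp
qed

definition slopes :: "'a::field \<Rightarrow> 'a set" where
  "slopes D = {Y / X | X Y. X \<noteq> 0 \<and> Y \<noteq> 0 \<and> Y ^ 2 = X ^ 3 - D ^ 2 * X}"

text \<open>
  Since $t^2 = (X^2 - D^2)/X$, the second claim is the identity
  $(X^2 - D^2)^2 + 4 D^2 X^2 = (X^2 + D^2)^2$.
\<close>

lemma slope_square:
  fixes D :: rat
  assumes "t \<in> slopes D"
  shows "t \<noteq> 0" "\<exists>w. t ^ 4 + 4 * D ^ 2 = w ^ 2"
proof -
  obtain X Y where XY: "X \<noteq> 0" "Y \<noteq> 0" "Y ^ 2 = X ^ 3 - D ^ 2 * X" and t: "t = Y / X"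
    using assms unfolding slopes_def by blast
  show "t \<noteq> 0" using t XY by simp
  have "t ^ 2 = (X ^ 2 - D ^ 2) / X"
    unfolding t power_divide XY(3) using XY(1)
    by (simp add: field_simps power2_eq_square power3_eq_cube)
  then have "t ^ 4 = ((X ^ 2 - D ^ 2) / X) ^ 2"
    by (metis power2_eq_square power4_eq_xxxx mult.assoc)
  then have "t ^ 4 + 4 * D ^ 2 = ((X ^ 2 + D ^ 2) / X) ^ 2"
    using XY(1) by (simp add: field_simps power2_eq_square)
  then show "\<exists>w. t ^ 4 + 4 * D ^ 2 = w ^ 2" by blast
qed

definition slope_params :: "'a::field \<Rightarrow> 'a \<Rightarrow> 'a \<Rightarrow> 'a \<Rightarrow> 'a set" where
  "slope_params D t1 t2 t3 =
     {t1 / (t2 * t3), t2 / (t1 * t3), t3 / (t1 * t2), t1 * t2 * t3 / (4 * D ^ 2)}"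

text \<open>
  Both kinds of products reduce to the same square: for $rs = t^2/(4 D^2)$ the sum is
  $(2 D/t^2)^2 (t^4 + 4 D^2)$.
\<close>

lemma slope_params_square:
  fixes D :: rat
  assumes "D \<noteq> 0" and t: "t1 \<in> slopes D" "t2 \<in> slopes D" "t3 \<in> slopes D"
    and rs: "r \<in> slope_params D t1 t2 t3" "s \<in> slope_params D t1 t2 t3" "r \<noteq> s"
  shows "\<exists>w. 4 * D ^ 2 + (1 / (r * s)) ^ 2 = w ^ 2"
proof -
  note nz = slope_square(1)[OF t(1)] slope_square(1)[OF t(2)] slope_square(1)[OF t(3)]
  have "\<exists>t \<in> slopes D. r * s = 1 / t ^ 2 \<or> r * s = t ^ 2 / (4 * D ^ 2)"
    using rs nz t \<open>D \<noteq> 0\<close> unfolding slope_params_def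
    by (auto simp: power2_eq_square intro: bexI[of _ t1] bexI[of _ t2] bexI[of _ t3])
  then obtain t where t: "t \<in> slopes D" and "r * s = 1 / t ^ 2 \<or> r * s = t ^ 2 / (4 * D ^ 2)"
    by blast
  then consider "r * s = 1 / t ^ 2" | "r * s = t ^ 2 / (4 * D ^ 2)" by blast
  then show ?thesis
  proof cases
    case 1
    then have "4 * D ^ 2 + (1 / (r * s)) ^ 2 = t ^ 4 + 4 * D ^ 2" by simp
    then show ?thesis using slope_square(2)[OF t] by metis
  next
    case 2
    obtain w where w: "t ^ 4 + 4 * D ^ 2 = w ^ 2" using slope_square(2)[OF t] by blast
    have "4 * D ^ 2 + (1 / (r * s)) ^ 2 = (2 * D / t ^ 2) ^ 2 * (t ^ 4 + 4 * D ^ 2)"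
      unfolding 2 using slope_square(1)[OF t] by (simp add: field_simps)
    also have "\<dots> = (2 * D / t ^ 2 * w) ^ 2"
      unfolding w by (simp add: power_mult_distrib power_divide)
    finally show ?thesis by blast
  qed
qed

lemma slope_params_rational_distance:
  fixes a b c d D :: rat
  assumes "a \<noteq> 0" "D = (a * d - b * c) / (2 * a ^ 2)" "D \<noteq> 0"
    and t: "t1 \<in> slopes D" "t2 \<in> slopes D" "t3 \<in> slopes D"
  shows "rational_distance_set_on (hyperbola a b c d)
           (hyperbola_point a b c d ` slope_params D t1 t2 t3)"
proof (rule hyperbola_points_rational_distance[OF assms(1,2)])
  show "r \<noteq> 0" if "r \<in> slope_params D t1 t2 t3" for r
    using that slope_square(1)[OF t(1)] slope_square(1)[OF t(2)] slope_square(1)[OF t(3)] assms(3)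
    unfolding slope_params_def by auto
qed (use slope_params_square[OF assms(3) t] in blast)

section \<open>Multiples of a point of infinite order\<close>

text \<open>
  The line of slope $l$ through the two points, counted with multiplicity: if the points coincide,
  the second equation says that $l$ is the slope of the tangent. For points of the curve with
  different abscissas it follows from the first one by dividing the difference of the two curve
  equations by $x_2 - x_1$. Chords and tangents thus need no separate treatment below.
\<close>

definition on_line :: "'a::field \<Rightarrow> 'a \<Rightarrow> 'a \<Rightarrow> 'a \<Rightarrow> 'a \<Rightarrow> 'a \<Rightarrow> bool" where
  "on_line D l x1 y1 x2 y2 \<longleftrightarrow>
     l * (x2 - x1) = y2 - y1 \<and> l * (y1 + y2) = x1 ^ 2 + x1 * x2 + x2 ^ 2 - D ^ 2"

lemma on_line_exists:
  fixes D :: "'a::field_char_0"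
  assumes "y1 ^ 2 = x1 ^ 3 - D ^ 2 * x1" "y2 ^ 2 = x2 ^ 3 - D ^ 2 * x2"
    and "\<not> (x1 = x2 \<and> y1 = - y2)"
  obtains l where "on_line D l x1 y1 x2 y2"
proof (cases "x1 = x2")
  case True
  then have "y1 ^ 2 = y2 ^ 2" using assms by simp
  then have y: "y1 = y2" "y2 \<noteq> 0"
    using assms(3) True by (auto simp: power2_eq_iff)
  then have "on_line D ((3 * x1 ^ 2 - D ^ 2) / (2 * y1)) x1 y1 x2 y2"
    unfolding on_line_def using True by (simp add: field_simps power2_eq_square)
  then show thesis by (rule that)
next
  case False
  let ?l = "(y2 - y1) / (x2 - x1)"
  have 1: "?l * (x2 - x1) = y2 - y1" using False by simp
  have "(x2 - x1) * (?l * (y1 + y2)) = (y2 - y1) * (y1 + y2)"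
    using False by simp
  also have "\<dots> = y2 ^ 2 - y1 ^ 2" by (simp add: algebra_simps power2_eq_square)
  also have "\<dots> = (x2 - x1) * (x1 ^ 2 + x1 * x2 + x2 ^ 2 - D ^ 2)"
    unfolding assms(1,2) by (simp add: algebra_simps power2_eq_square power3_eq_cube)
  finally have "?l * (y1 + y2) = x1 ^ 2 + x1 * x2 + x2 ^ 2 - D ^ 2"
    using False by simp
  with 1 show thesis using that unfolding on_line_def by blast
qed

lemma ell_add_on_line:
  fixes D :: "'a::field_char_0"
  assumes "\<not> (x1 = x2 \<and> y1 = - y2)" and line: "on_line D l x1 y1 x2 y2"
    and x3: "x3 = l ^ 2 - x1 - x2" and y3: "y3 = l * (x1 - x3) - y1"
  shows "ell_add D (hom3 x1 y1 1) (hom3 x2 y2 1) = hom3 x3 y3 1"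
proof -
  have "(if x1 = x2 then (3 * x1 ^ 2 - D ^ 2) / (2 * y1) else (y2 - y1) / (x2 - x1)) = l"
  proof (cases "x1 = x2")
    case True
    then have y: "y1 = y2" using line unfolding on_line_def by simp
    then have "y1 \<noteq> 0" using True assms(1) by auto
    then show ?thesis
      using line True y unfolding on_line_def by (simp add: field_simps power2_eq_square)
  next
    case False
    then show ?thesis using line unfolding on_line_def by (simp add: field_simps)
  qed
  then show ?thesis
    using assms(1) unfolding ell_add_def x3 y3 by (simp add: Let_def)
qed

text \<open>
  Reflection in the horizontal axis negates slopes. As $(x_3, -y_3)$ is the third intersection
  of the line with the curve, the reflected line joins $(x_3, y_3)$ to $(x_2, -y_2)$, also when
  these two points coincide.
\<close>

lemma on_line_third_point:
  fixes D :: "'a::field_char_0"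
  assumes line: "on_line D l x1 y1 x2 y2"
    and x3: "x3 = l ^ 2 - x1 - x2" and y3: "y3 = l * (x1 - x3) - y1"
  shows "on_line D (- l) x3 y3 x2 (- y2)"
  unfolding on_line_def
proof
  show "- l * (x2 - x3) = - y2 - y3"
    unfolding y3 using line unfolding on_line_def by (simp add: algebra_simps)
  have "- l * (y3 + - y2) = l * (y1 + y2) - l ^ 2 * (x1 - x3)"
    unfolding y3 by (simp add: algebra_simps power2_eq_square)
  also have "l ^ 2 = x1 + x2 + x3"
    unfolding x3 by simp
  also have "l * (y1 + y2) = x1 ^ 2 + x1 * x2 + x2 ^ 2 - D ^ 2"
    using line unfolding on_line_def by simp
  finally show "- l * (y3 + - y2) = x3 ^ 2 + x3 * x2 + x2 ^ 2 - D ^ 2"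
    by (simp add: algebra_simps power2_eq_square)
qed

text \<open>
  On the line, $X^3 - D^2 X - Y^2$ is the cubic $(X - x_1)(X - x_2)(X - x_3)$, whose root $x_3$ is
  determined by $x_1 + x_2 + x_3 = l^2$.
\<close>

lemma third_point_in_ell_curve:
  fixes D :: "'a::field_char_0"
  assumes line: "on_line D l x1 y1 x2 y2" and curve: "y1 ^ 2 = x1 ^ 3 - D ^ 2 * x1"
    and x3: "x3 = l ^ 2 - x1 - x2" and y3: "y3 = l * (x1 - x3) - y1"
  shows "y3 ^ 2 = x3 ^ 3 - D ^ 2 * x3"
proof -
  have l1: "l * (x2 - x1) = y2 - y1" and l2: "l * (y1 + y2) = x1 ^ 2 + x1 * x2 + x2 ^ 2 - D ^ 2"
    using line unfolding on_line_def by auto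
  have sq: "l ^ 2 = x1 + x2 + x3"
    unfolding x3 by simp
  have "2 * l * y1 = l * (y1 + y2) - l * (y2 - y1)"
    by (simp add: algebra_simps)
  also have "\<dots> = x1 ^ 2 + x1 * x2 + x2 ^ 2 - D ^ 2 - (x1 + x2 + x3) * (x2 - x1)"
    unfolding l2 l1[symmetric] sq[symmetric] by (simp add: algebra_simps power2_eq_square)
  finally have lin: "2 * l * y1 = x1 ^ 2 + x1 * x2 + x2 ^ 2 - D ^ 2 - (x1 + x2 + x3) * (x2 - x1)" .
  have "y3 ^ 2 = l ^ 2 * (x1 - x3) ^ 2 - 2 * l * y1 * (x1 - x3) + y1 ^ 2"
    unfolding y3 by (simp add: algebra_simps power2_eq_square)
  also have "\<dots> = x3 ^ 3 - D ^ 2 * x3"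
    unfolding sq lin curve by (simp add: algebra_simps power2_eq_square power3_eq_cube)
  finally show ?thesis .
qed

lemma ell_add_infinity [simp]:
  "ell_add D (hom3 0 1 0) Q = Q" "ell_add D P (hom3 0 1 0) = P"
  by (simp_all add: ell_add_def)

lemma ell_add_opposite: "ell_add D (hom3 x y 1) (hom3 x (- y) 1) = hom3 0 1 0"
  by (simp add: ell_add_def)

lemma ell_add_closed:
  fixes D :: "'a::field_char_0"
  assumes P: "P \<in> ell_curve D" and Q: "Q \<in> ell_curve D"
  shows "ell_add D P Q \<in> ell_curve D"
proof (cases rule: ell_curve_cases[OF P])
  case 1
  then show ?thesis using Q by simp
next
  case P: (2 x1 y1)
  show ?thesis
  proof (cases rule: ell_curve_cases[OF Q])
    case 1
    then show ?thesis using assms(1) by simp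
  next
    case Q: (2 x2 y2)
    show ?thesis
    proof (cases "x1 = x2 \<and> y1 = - y2")
      case True
      then show ?thesis
        using infinity_in_ell_curve by (simp add: P Q ell_add_def)
    next
      case False
      then obtain l where l: "on_line D l x1 y1 x2 y2"
        using P(2) Q(2) on_line_exists by blast
      show ?thesis
        unfolding P(1) Q(1) ell_add_on_line[OF False l refl refl] affine_in_ell_curve_iff
        using third_point_in_ell_curve[OF l P(2) refl refl] .
    qed
  qed
qed

text \<open>
  The second addition would degenerate only if $Q + P = P$. In that case the reflected line, which
  has a finite slope, would contain both $(x, y)$ and $(x, -y)$; the condition $y \<noteq> 0$ excludes
  this.
\<close>

lemma ell_add_cancel:
  fixes D :: "'a::field_char_0"
  assumes Q: "Q \<in> ell_curve D" and P: "hom3 x y 1 \<in> ell_curve D" and "y \<noteq> 0"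
  shows "ell_add D (ell_add D Q (hom3 x y 1)) (hom3 x (- y) 1) = Q"
proof (cases rule: ell_curve_cases[OF Q])
  case 1
  then show ?thesis by (simp add: ell_add_opposite)
next
  case Q: (2 x1 y1)
  show ?thesis
  proof (cases "x1 = x \<and> y1 = - y")
    case True
    then show ?thesis using ell_add_opposite[of D x "- y"] by (simp add: Q)
  next
    case False
    obtain l where l: "on_line D l x1 y1 x y"
      using P Q(2) False on_line_exists affine_in_ell_curve_iff by metis
    define x3 where "x3 = l ^ 2 - x1 - x"
    define y3 where "y3 = l * (x1 - x3) - y1"
    have l': "on_line D (- l) x3 y3 x (- y)"
      using on_line_third_point[OF l x3_def y3_def] .
    have "\<not> (x3 = x \<and> y3 = - (- y))"
      using l' \<open>y \<noteq> 0\<close> unfolding on_line_def by auto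
    moreover have "x1 = (- l) ^ 2 - x3 - x" "y1 = - l * (x3 - x1) - y3"
      unfolding y3_def x3_def by (simp_all add: algebra_simps)
    ultimately have "ell_add D (hom3 x3 y3 1) (hom3 x (- y) 1) = hom3 x1 y1 1"
      by (intro ell_add_on_line[OF _ l'])
    then show ?thesis
      using ell_add_on_line[OF False l x3_def y3_def] Q(1) by simp
  qed
qed

text \<open>
  A point with $Y = 0$ is its own negative, and $X = 0$ forces $Y = 0$.
\<close>

lemma infinite_order_point_affine:
  fixes D :: "'a::field_char_0"
  assumes P: "P \<in> ell_curve D" and ord: "\<not> finite_order (ell_group D) P"
  obtains X Y where "P = hom3 X Y 1" "X \<noteq> 0" "Y \<noteq> 0" "Y ^ 2 = X ^ 3 - D ^ 2 * X"
proof -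
  have no_pow: "P [^]\<^bsub>ell_group D\<^esub> n \<noteq> hom3 0 1 0" if "n > 0" for n :: nat
    using ord that unfolding finite_order_def by (metis monoid.select_convs(2) ell_group_def)
  show thesis
  proof (cases rule: ell_curve_cases[OF P])
    case 1
    then show thesis using no_pow[of 1] by (simp add: ell_group_def)
  next
    case (2 X Y)
    have "Y \<noteq> 0"
    proof
      assume "Y = 0"
      then have "ell_add D P P = hom3 0 1 0"
        using ell_add_opposite[of D X 0] by (simp add: 2)
      then show False
        using no_pow[of "Suc (Suc 0)"] by (simp add: ell_group_def)
    qed
    then have "X \<noteq> 0" using 2(2) by auto
    then show thesis using that[OF 2(1) _ \<open>Y \<noteq> 0\<close> 2(2)] by blast
  qed
qed

text \<open>
  If $m P = n P$ with $m < n$, cancelling $P$ repeatedly gives $(n - m) P = 0$.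
\<close>

lemma infinite_order_imp_infinite_ell_curve:
  fixes D :: "'a::field_char_0"
  assumes P: "P \<in> ell_curve D" and ord: "\<not> finite_order (ell_group D) P"
  shows "infinite (ell_curve D)"
proof -
  let ?p = "\<lambda>n::nat. P [^]\<^bsub>ell_group D\<^esub> n"
  obtain X Y where XY: "P = hom3 X Y 1" "Y \<noteq> 0"
    using infinite_order_point_affine[OF assms] by metis
  have p_0: "?p 0 = hom3 0 1 0" and p_Suc: "?p (Suc n) = ell_add D (?p n) P" for n
    by (simp_all add: ell_group_def)
  have closed: "?p n \<in> ell_curve D" for n
    by (induction n) (simp_all only: p_0 p_Suc infinity_in_ell_curve ell_add_closed P)
  have "?p m \<noteq> ?p n" if "m < n" for m n
    using that
  proof (induction m arbitrary: n)
    case 0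
    then show ?case
      using ord unfolding finite_order_def by (metis monoid.select_convs(2) ell_group_def nat_pow_0)
  next
    case (Suc m)
    then obtain k where k: "n = Suc k" "m < k" by (cases n) auto
    show ?case
    proof
      assume "?p (Suc m) = ?p n"
      then have "ell_add D (?p m) P = ell_add D (?p k) P"
        unfolding k p_Suc .
      then have "?p m = ?p k"
        using ell_add_cancel[OF closed P[unfolded XY(1)] XY(2)] unfolding XY(1) by metis
      then show False using Suc.IH k(2) by blast
    qed
  qed
  then have "inj ?p"
    by (metis injI nat_neq_iff)
  then show ?thesis
    using closed range_inj_infinite[of ?p] by (meson finite_subset image_subsetI)
qed

text \<open>
  This evaluates a product in a structure not known to be a commutative monoid, by going back to
  the fold relation: along it, only products of the unit with itself occur.
\<close>

lemma finprod_trivial: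
  assumes "finite A" and one: "\<one>\<^bsub>G\<^esub> \<in> carrier G" "\<one>\<^bsub>G\<^esub> \<otimes>\<^bsub>G\<^esub> \<one>\<^bsub>G\<^esub> = \<one>\<^bsub>G\<^esub>"
    and f: "\<And>x. x \<in> A \<Longrightarrow> f x = \<one>\<^bsub>G\<^esub>"
  shows "finprod G f A = \<one>\<^bsub>G\<^esub>"
proof -
  let ?R = "foldSetD (carrier G) (mult G \<circ> f) \<one>\<^bsub>G\<^esub>"
  have "(A, \<one>\<^bsub>G\<^esub>) \<in> ?R"
    using assms(1) f
  proof (induction A rule: finite_induct)
    case empty
    show ?case using one(1) by (rule foldSetD.emptyI)
  next
    case (insert x A)
    have "(mult G \<circ> f) x \<one>\<^bsub>G\<^esub> = \<one>\<^bsub>G\<^esub>"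
      using insert.prems one(2) by simp
    then show ?case
      using foldSetD.insertI[OF insert.hyps(2) _ insert.IH] insert.prems one(1) by (metis insertI2)
  qed
  moreover have "z = \<one>\<^bsub>G\<^esub>" if "(A, z) \<in> ?R" for z
    using that f by (induction rule: foldSetD.induct) (simp_all add: one)
  ultimately show ?thesis
    unfolding finprod_def foldD_def using assms(1) by (auto intro: the_equality)
qed

text \<open>
  A member $P$ of an independent set cannot satisfy $n P = 0$ with $n > 0$, as the family with
  coefficient $n$ at $P$ and $0$ elsewhere would be a nontrivial relation.
\<close>

lemma positive_rank_imp_infinite_order_point:
  assumes "ab_rank (ell_group D) > 0"
  obtains P where "P \<in> ell_curve D" "\<not> finite_order (ell_group D) P"
proof -
  let ?G = "ell_group D"
  obtain A where A: "finite A" "A \<subseteq> carrier ?G" "int_independent ?G A" "card A > 0"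
    using assms unfolding ab_rank_def less_SUP_iff by (auto simp: zero_enat_def)
  then obtain P where P: "P \<in> A" by (metis card_gt_0_iff ex_in_conv)
  have "\<not> finite_order ?G P"
  proof
    assume "finite_order ?G P"
    then obtain n :: nat where n: "n > 0" "P [^]\<^bsub>?G\<^esub> n = \<one>\<^bsub>?G\<^esub>"
      unfolding finite_order_def by blast
    \<comment> \<open>the conversion stands outside the conditional, so that the integer powers become natural powers\<close>
    let ?k = "\<lambda>x. int (if x = P then n else 0)"
    have "finprod ?G (\<lambda>x. x [^]\<^bsub>?G\<^esub> ?k x) A = \<one>\<^bsub>?G\<^esub>"
    proof (rule finprod_trivial[OF A(1)])
      show "\<one>\<^bsub>?G\<^esub> \<in> carrier ?G" "\<one>\<^bsub>?G\<^esub> \<otimes>\<^bsub>?G\<^esub> \<one>\<^bsub>?G\<^esub> = \<one>\<^bsub>?G\<^esub>"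
        by (simp_all add: ell_group_def infinity_in_ell_curve)
      show "x [^]\<^bsub>?G\<^esub> ?k x = \<one>\<^bsub>?G\<^esub>" for x
        unfolding int_pow_int using n(2) by simp
    qed
    then have "\<forall>x\<in>A. ?k x = 0"
      by (rule A(3)[unfolded int_independent_def, THEN spec, of ?k, THEN mp])
    then have "?k P = 0" using P by (rule bspec)
    then show False using n(1) by simp
  qed
  moreover have "P \<in> ell_curve D" using P A(2) by (auto simp: ell_group_def)
  ultimately show thesis using that by blast
qed

section \<open>Infinitely many rational distance sets\<close>

text \<open>
  A slope $t$ belongs to at most two points, because $Y = t X$ turns the curve equation into
  $X^2 - t^2 X - D^2 = 0$ for $X \<noteq> 0$. The points without a slope in the set are the point at
  infinity and those with $Y = 0$, at most four in number.
\<close>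

lemma infinite_slopes:
  fixes D :: "'a::field_char_0"
  assumes "infinite (ell_curve D)"
  shows "infinite (slopes D)"
proof
  assume fin: "finite (slopes D)"
  let ?A = "insert (hom3 0 1 0) ((\<lambda>X. hom3 X 0 1) ` {0, D, - D}
      \<union> (\<Union>t \<in> slopes D. (\<lambda>X. hom3 X (t * X) 1) ` {X. poly [:- (D ^ 2), - (t ^ 2), 1:] X = 0}))"
  have "ell_curve D \<subseteq> ?A"
  proof
    fix P assume "P \<in> ell_curve D"
    then show "P \<in> ?A"
    proof (cases rule: ell_curve_cases)
      case (2 X Y)
      show ?thesis
      proof (cases "Y = 0")
        case True
        then have "X * ((X - D) * (X + D)) = 0"
          using 2(2) True by (auto simp: algebra_simps power2_eq_square power3_eq_cube)
        then have "X \<in> {0, D, - D}" by (auto simp: add_eq_0_iff2)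
        then show ?thesis using 2(1) True by blast
      next
        case False
        then have X: "X \<noteq> 0" using 2(2) by auto
        have "Y / X \<in> slopes D" using 2(2) X False unfolding slopes_def by blast
        moreover have "(Y / X) ^ 2 * X = X ^ 2 - D ^ 2"
          unfolding power_divide 2(2) using X
          by (simp add: field_simps power2_eq_square power3_eq_cube)
        then have "poly [:- (D ^ 2), - ((Y / X) ^ 2), 1:] X = 0"
          by (simp add: algebra_simps power2_eq_square)
        moreover have "P = hom3 X (Y / X * X) 1" using 2(1) X by simp
        ultimately show ?thesis by blast
      qed
    qed simp
  qed
  moreover have "finite ?A"
    by (intro finite.insertI finite_UnI finite_UN_I finite_imageI poly_roots_finite fin) simp_all
  ultimately show False using assms finite_subset by blast
qed

lemma finite_square_roots: "finite {t::'a::field_char_0. t ^ 2 = u}"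
proof (cases "\<exists>s. s ^ 2 = u")
  case True
  then obtain s where "s ^ 2 = u" by blast
  then have "{t. t ^ 2 = u} \<subseteq> {s, - s}" by (auto simp: power2_eq_iff)
  then show ?thesis by (rule finite_subset) simp
qed simp

text \<open>
  The quotient of two of the first three parameters is $t_i^2/t_j^2$, and that of one of them and
  the last is $4 D^2/(t_j t_k)^2$.
\<close>

lemma card_slope_params:
  fixes D :: rat
  assumes "D \<noteq> 0" "t1 \<noteq> 0" "t2 \<noteq> 0" "t3 \<noteq> 0"
    and "t1 ^ 2 \<noteq> t2 ^ 2" "t1 ^ 2 \<noteq> t3 ^ 2" "t2 ^ 2 \<noteq> t3 ^ 2"
    and "(t1 * t2) ^ 2 \<noteq> 4 * D ^ 2" "(t1 * t3) ^ 2 \<noteq> 4 * D ^ 2" "(t2 * t3) ^ 2 \<noteq> 4 * D ^ 2"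
  shows "card (slope_params D t1 t2 t3) = 4"
proof -
  have "distinct [t1 / (t2 * t3), t2 / (t1 * t3), t3 / (t1 * t2), t1 * t2 * t3 / (4 * D ^ 2)]"
    using assms by (simp add: field_simps power2_eq_square)
  then show ?thesis
    using distinct_card unfolding slope_params_def by fastforce
qed

text \<open>
  Fix $t_1$ and $t_2$ and vary $t_3$. Counting sets directly would require telling them apart;
  instead, finitely many sets of four points have a finite union, whereas the points with
  parameters $t_3/(t_1 t_2)$ are infinitely many.
\<close>

lemma infinitely_many_rational_distance_sets:
  fixes a b c d D :: rat
  assumes "a \<noteq> 0" and D: "D = (a * d - b * c) / (2 * a ^ 2)" and "D \<noteq> 0"
    and inf: "infinite (slopes D)"
  shows "infinite {S. rational_distance_set_on (hyperbola a b c d) S \<and> card S = 4}" (is "infinite ?F")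
proof
  assume fin: "finite ?F"
  have scaled: "finite {t. (s * t) ^ 2 = 4 * D ^ 2}" if "s \<noteq> 0" for s :: rat
  proof -
    have "{t. (s * t) ^ 2 = 4 * D ^ 2} = {t. t ^ 2 = 4 * D ^ 2 / s ^ 2}"
      using that by (auto simp: field_simps power_mult_distrib)
    then show ?thesis using finite_square_roots by simp
  qed
  obtain t1 where t1: "t1 \<in> slopes D"
    using inf infinite_imp_nonempty by blast
  have t1_nz: "t1 \<noteq> 0" using slope_square(1)[OF t1] .
  have "infinite (slopes D - ({t. t ^ 2 = t1 ^ 2} \<union> {t. (t1 * t) ^ 2 = 4 * D ^ 2}))"
    using inf finite_square_roots scaled[OF t1_nz] by (intro Diff_infinite_finite) auto
  then obtain t2 where "t2 \<in> slopes D - ({t. t ^ 2 = t1 ^ 2} \<union> {t. (t1 * t) ^ 2 = 4 * D ^ 2})"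
    using infinite_imp_nonempty by blast
  then have t2: "t2 \<in> slopes D" "t1 ^ 2 \<noteq> t2 ^ 2" "(t1 * t2) ^ 2 \<noteq> 4 * D ^ 2"
    by auto
  have t2_nz: "t2 \<noteq> 0" using slope_square(1)[OF t2(1)] .
  \<comment> \<open>the third slopes for which the four parameters are distinct\<close>
  define T where "T = slopes D - ({t. t ^ 2 = t1 ^ 2} \<union> {t. t ^ 2 = t2 ^ 2}
      \<union> {t. (t1 * t) ^ 2 = 4 * D ^ 2} \<union> {t. (t2 * t) ^ 2 = 4 * D ^ 2})"
  have T_inf: "infinite T"
    unfolding T_def using inf finite_square_roots scaled[OF t1_nz] scaled[OF t2_nz]
    by (intro Diff_infinite_finite) auto
  have inj: "inj (hyperbola_point a b c d)"
    using \<open>D \<noteq> 0\<close> by (auto intro!: injI simp: hyperbola_point_affine[OF assms(1) D])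
  let ?S = "\<lambda>t. hyperbola_point a b c d ` slope_params D t1 t2 t"
  have S: "?S t \<in> ?F" if "t \<in> T" for t
  proof -
    have t: "t \<in> slopes D" "t1 ^ 2 \<noteq> t ^ 2" "t2 ^ 2 \<noteq> t ^ 2"
        "(t1 * t) ^ 2 \<noteq> 4 * D ^ 2" "(t2 * t) ^ 2 \<noteq> 4 * D ^ 2"
      using that unfolding T_def by auto
    have "card (?S t) = card (slope_params D t1 t2 t)"
      by (intro card_image inj_on_subset[OF inj]) simp
    also have "\<dots> = 4"
      using card_slope_params[OF \<open>D \<noteq> 0\<close> t1_nz t2_nz slope_square(1)[OF t(1)] t2(2) t(2,3) t2(3) t(4,5)] .
    finally show ?thesis
      using slope_params_rational_distance[OF assms(1) D \<open>D \<noteq> 0\<close> t1 t2(1) t(1)] by blast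
  qed
  let ?g = "\<lambda>t. hyperbola_point a b c d (t / (t1 * t2))"
  have "finite (\<Union> ?F)"
  proof (rule finite_Union[OF fin])
    show "finite S" if "S \<in> ?F" for S
      using that card_ge_0_finite[of S] by simp
  qed
  moreover have "?g ` T \<subseteq> \<Union> ?F"
  proof (rule image_subsetI)
    fix t assume "t \<in> T"
    moreover have "?g t \<in> ?S t" unfolding slope_params_def by simp
    ultimately show "?g t \<in> \<Union> ?F" by (intro UnionI[OF S])
  qed
  moreover have "inj_on ?g T"
  proof (rule inj_onI)
    fix s t assume "?g s = ?g t"
    then have "s / (t1 * t2) = t / (t1 * t2)" by (rule injD[OF inj])
    then show "s = t" using t1_nz t2_nz by simp
  qed
  ultimately have "finite T"
    using finite_subset finite_imageD by blast
  then show False using T_inf by blast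
qed

theorem theorem6:
  fixes a b c d D :: rat
  assumes "a * (a * d - b * c) \<noteq> 0"
    and "D = (a * d - b * c) / (2 * a ^ 2)"
  shows
    "(\<exists>f :: (complex ^ 3) set \<Rightarrow> (complex ^ 3) set \<times> (complex ^ 2) set.
        morphism_to_surface (of_rat D) f \<and>
        \<not> (\<exists>Q. \<forall>P \<in> ell_curve (of_rat D). f P = Q) \<and>
        (\<exists>t. \<forall>P \<in> ell_curve (of_rat D). snd (f P) = t))
     \<and>
     (\<forall>X1 Y1 X2 Y2 X3 Y3 :: rat.
        hom3 X1 Y1 1 \<in> ell_curve D \<and> \<not> finite_order (ell_group D) (hom3 X1 Y1 1) \<and>
        hom3 X2 Y2 1 \<in> ell_curve D \<and> \<not> finite_order (ell_group D) (hom3 X2 Y2 1) \<and>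
        hom3 X3 Y3 1 \<in> ell_curve D \<and> \<not> finite_order (ell_group D) (hom3 X3 Y3 1) \<longrightarrow>
        rational_distance_set_on (hyperbola a b c d)
          {hom3 (- a * c + (a * d - b * c) * ((Y1 * X2 * X3) / (X1 * Y2 * Y3)))
                (- a * b - a ^ 2 * ((X1 * Y2 * Y3) / (Y1 * X2 * X3)))
                (a ^ 2),
           hom3 (- a * c + (a * d - b * c) * ((X1 * Y2 * X3) / (Y1 * X2 * Y3)))
                (- a * b - a ^ 2 * ((Y1 * X2 * Y3) / (X1 * Y2 * X3)))
                (a ^ 2),
           hom3 (- a * c + (a * d - b * c) * ((X1 * X2 * Y3) / (Y1 * Y2 * X3)))
                (- a * b - a ^ 2 * ((Y1 * Y2 * X3) / (X1 * X2 * Y3)))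
                (a ^ 2),
           hom3 (- a * c + (a * d - b * c) / (4 * D ^ 2) * ((Y1 * Y2 * Y3) / (X1 * X2 * X3)))
                (- a * b - 4 * D ^ 2 * a ^ 2 * ((X1 * X2 * X3) / (Y1 * Y2 * Y3)))
                (a ^ 2)})
     \<and>
     (ab_rank (ell_group D) > 0 \<longrightarrow>
        infinite {S. rational_distance_set_on (hyperbola a b c d) S \<and> card S = 4})"
proof (intro conjI allI impI)
  have a: "a \<noteq> 0" and "D \<noteq> 0" using assms by auto
  show "\<exists>f :: (complex ^ 3) set \<Rightarrow> (complex ^ 3) set \<times> (complex ^ 2) set.
        morphism_to_surface (of_rat D) f \<and>
        \<not> (\<exists>Q. \<forall>P \<in> ell_curve (of_rat D). f P = Q) \<and>
        (\<exists>t. \<forall>P \<in> ell_curve (of_rat D). snd (f P) = t)"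
    using fibre_map_exists[OF \<open>D \<noteq> 0\<close>] .
  show "infinite {S. rational_distance_set_on (hyperbola a b c d) S \<and> card S = 4}"
    if rank: "ab_rank (ell_group D) > 0"
  proof -
    obtain P where "P \<in> ell_curve D" "\<not> finite_order (ell_group D) P"
      using positive_rank_imp_infinite_order_point[OF rank] .
    then show ?thesis
      using infinitely_many_rational_distance_sets[OF a assms(2) \<open>D \<noteq> 0\<close>] infinite_slopes
        infinite_order_imp_infinite_ell_curve by blast
  qed
  fix X1 Y1 X2 Y2 X3 Y3 :: rat
  assume points: "hom3 X1 Y1 1 \<in> ell_curve D \<and> \<not> finite_order (ell_group D) (hom3 X1 Y1 1) \<and>
        hom3 X2 Y2 1 \<in> ell_curve D \<and> \<not> finite_order (ell_group D) (hom3 X2 Y2 1) \<and>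
        hom3 X3 Y3 1 \<in> ell_curve D \<and> \<not> finite_order (ell_group D) (hom3 X3 Y3 1)"
  have slope: "X \<noteq> 0 \<and> Y \<noteq> 0 \<and> Y / X \<in> slopes D"
    if "hom3 X Y 1 \<in> ell_curve D" "\<not> finite_order (ell_group D) (hom3 X Y 1)" for X Y
    by (rule infinite_order_point_affine[OF that]) (auto simp: slopes_def)
  have nz: "X1 \<noteq> 0" "Y1 \<noteq> 0" "X2 \<noteq> 0" "Y2 \<noteq> 0" "X3 \<noteq> 0" "Y3 \<noteq> 0"
    and t: "Y1 / X1 \<in> slopes D" "Y2 / X2 \<in> slopes D" "Y3 / X3 \<in> slopes D"
    using points slope by blast+
  let ?h = "hyperbola_point a b c d"
  have eq1: "?h (Y1 / X1 / (Y2 / X2 * (Y3 / X3))) =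
      hom3 (- a * c + (a * d - b * c) * ((Y1 * X2 * X3) / (X1 * Y2 * Y3)))
        (- a * b - a ^ 2 * ((X1 * Y2 * Y3) / (Y1 * X2 * X3))) (a ^ 2)"
    by (simp add: hyperbola_point_def mult_ac)
  have eq2: "?h (Y2 / X2 / (Y1 / X1 * (Y3 / X3))) =
      hom3 (- a * c + (a * d - b * c) * ((X1 * Y2 * X3) / (Y1 * X2 * Y3)))
        (- a * b - a ^ 2 * ((Y1 * X2 * Y3) / (X1 * Y2 * X3))) (a ^ 2)"
    by (simp add: hyperbola_point_def mult_ac)
  have eq3: "?h (Y3 / X3 / (Y1 / X1 * (Y2 / X2))) =
      hom3 (- a * c + (a * d - b * c) * ((X1 * X2 * Y3) / (Y1 * Y2 * X3)))
        (- a * b - a ^ 2 * ((Y1 * Y2 * X3) / (X1 * X2 * Y3))) (a ^ 2)"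
    by (simp add: hyperbola_point_def mult_ac)
  have eq4: "?h (Y1 / X1 * (Y2 / X2) * (Y3 / X3) / (4 * D ^ 2)) =
      hom3 (- a * c + (a * d - b * c) / (4 * D ^ 2) * ((Y1 * Y2 * Y3) / (X1 * X2 * X3)))
        (- a * b - 4 * D ^ 2 * a ^ 2 * ((X1 * X2 * X3) / (Y1 * Y2 * Y3))) (a ^ 2)"
    by (simp add: hyperbola_point_def mult_ac)
  show "rational_distance_set_on (hyperbola a b c d)
          {hom3 (- a * c + (a * d - b * c) * ((Y1 * X2 * X3) / (X1 * Y2 * Y3)))
                (- a * b - a ^ 2 * ((X1 * Y2 * Y3) / (Y1 * X2 * X3)))
                (a ^ 2),
           hom3 (- a * c + (a * d - b * c) * ((X1 * Y2 * X3) / (Y1 * X2 * Y3)))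
                (- a * b - a ^ 2 * ((Y1 * X2 * Y3) / (X1 * Y2 * X3)))
                (a ^ 2),
           hom3 (- a * c + (a * d - b * c) * ((X1 * X2 * Y3) / (Y1 * Y2 * X3)))
                (- a * b - a ^ 2 * ((Y1 * Y2 * X3) / (X1 * X2 * Y3)))
                (a ^ 2),
           hom3 (- a * c + (a * d - b * c) / (4 * D ^ 2) * ((Y1 * Y2 * Y3) / (X1 * X2 * X3)))
                (- a * b - 4 * D ^ 2 * a ^ 2 * ((X1 * X2 * X3) / (Y1 * Y2 * Y3)))
                (a ^ 2)}"
    using slope_params_rational_distance[OF a assms(2) \<open>D \<noteq> 0\<close> t]
    unfolding slope_params_def image_insert image_empty eq1 eq2 eq3 eq4 .
qed

end
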